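(* Let $0\le\alpha\le 1$ and let $f\in\mathcal{BK}(\alpha)$ have the Taylor expansion $f(z)=z+\sum_{n=2}^\infty a_nz^n$ in $\mathbb{D}$. Then $$|a_2|\le \frac12,\qquad |a_3|\le \frac16,\qquad |a_4|\le\begin{cases}\dfrac1{12}, & 0\le\alpha\le\frac12,\\[2mm] \dfrac{1+2\alpha}{24}, & \frac12\le\alpha\le 1.\end{cases}$$ The estimates $|a_2|\le\frac12$, $|a_3|\le\frac16$ and (for $\frac12\le\alpha\le1$) $|a_4|\le\frac{1+2\alpha}{24}$ are sharp, with equality for the function $g_1\in\mathcal{BK}(\alpha)$ defined by $$g_1(z)=\int_0^z\exp\left(\int_0^u\frac{dt}{1-\alpha t^2}\right)du=z+\frac{z^2}{2!}+\frac{z^3}{3!}+\frac{1+2\alpha}{4!}z^4+\cdots .$$ The estimate $|a_4|\le\frac1{12}$ (for $0\le\alpha\le\frac12$) is sharp, with equality for the function $g_2\in\mathcal{BK}(\alpha)$ defined by $$g_2(z)=\int_0^z\left(\frac{1+\sqrt{\alpha}\,t^3}{1-\sqrt{\alpha}\,t^3}\right)^{\frac{1}{6\sqrt{\alpha}}}dt=z+\frac1{12}z^4+\cdots,$$ where for $\alpha=0$ the integrand is understood as its limit $\exp(t^3/3)$ as $\alpha\to0^+$.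
   Context: $\mathbb{D}=\{z\in\mathbb{C}:|z|<1\}$. $\mathcal{A}$ is the class of analytic functions $f$ in $\mathbb{D}$ with $f(0)=0$, $f'(0)=1$. For analytic $f,g$ in $\mathbb{D}$, $f$ is subordinate to $g$, written $f\prec g$, if there is an analytic $\omega:\mathbb{D}\to\mathbb{D}$ with $\omega(0)=0$ and $f(z)=g(\omega(z))$ for all $z\in\mathbb{D}$. For $0\le\alpha\le1$ let $F_\alpha(z)=\dfrac{z}{1-\alpha z^2}$, and let $\mathcal{BK}(\alpha)$ be the class of $f\in\mathcal{A}$ such that $\dfrac{zf''(z)}{f'(z)}\prec F_\alpha(z)$ (in particular $zf''/f'$ is analytic in $\mathbb{D}$). Powers are taken with the principal branch (value $1$ at $t=0$). *)

theory Defs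
  imports "HOL-Complex_Analysis.Complex_Analysis"
begin

abbreviation unit_disc :: "complex set" where
  "unit_disc \<equiv> ball 0 1"

definition class_A :: "(complex \<Rightarrow> complex) set" where
  "class_A = {f. f holomorphic_on unit_disc \<and> f 0 = 0 \<and> deriv f 0 = 1}"

definition subordinate :: "(complex \<Rightarrow> complex) \<Rightarrow> (complex \<Rightarrow> complex) \<Rightarrow> bool" where
  "subordinate f g \<longleftrightarrow>
     f holomorphic_on unit_disc \<and> g holomorphic_on unit_disc \<and>
     (\<exists>\<omega>. \<omega> holomorphic_on unit_disc \<and> \<omega> ` unit_disc \<subseteq> unit_disc \<and> \<omega> 0 = 0 \<and>
          (\<forall>z\<in>unit_disc. f z = g (\<omega> z)))"

definition F_fun :: "real \<Rightarrow> complex \<Rightarrow> complex" where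
  "F_fun \<alpha> z = z / (1 - of_real \<alpha> * z ^ 2)"

text \<open>Analyticity of \<open>z f''(z) / f'(z)\<close> in the disc means that \<open>f'\<close> has no zeros there
  (a zero of \<open>f'\<close> would be a pole of the quotient). This is stated explicitly, so that the
  convention \<open>x / 0 = 0\<close> plays no role.\<close>

definition class_BK :: "real \<Rightarrow> (complex \<Rightarrow> complex) set" where
  "class_BK \<alpha> = {f \<in> class_A. (\<forall>z\<in>unit_disc. deriv f z \<noteq> 0) \<and>
     subordinate (\<lambda>z. z * deriv (deriv f) z / deriv f z) (F_fun \<alpha>)}"

text \<open>\<open>f(z) = z + (\<Sum>n\<ge>2. a\<^sub>n z\<^sup>n)\<close> in the disc; the values \<open>a 0\<close> and \<open>a 1\<close> are not used.\<close>

definition has_normalized_expansion :: "(complex \<Rightarrow> complex) \<Rightarrow> (nat \<Rightarrow> complex) \<Rightarrow> bool" where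
  "has_normalized_expansion f a \<longleftrightarrow>
     (\<forall>z\<in>unit_disc. (\<lambda>n. a (n + 2) * z ^ (n + 2)) sums (f z - z))"

text \<open>Integrals from \<open>0\<close> to \<open>z\<close> are taken along the straight segment; the integrands are
  analytic in the disc, so the choice of the path inside the disc is immaterial.\<close>

definition g1 :: "real \<Rightarrow> complex \<Rightarrow> complex" where
  "g1 \<alpha> z = contour_integral (linepath 0 z)
     (\<lambda>u. exp (contour_integral (linepath 0 u) (\<lambda>t. 1 / (1 - of_real \<alpha> * t ^ 2))))"

text \<open>\<open>powr\<close> is the principal power \<open>exp (a * Ln w)\<close>; here \<open>w\<close> has positive real part.\<close>

definition g2_integrand :: "real \<Rightarrow> complex \<Rightarrow> complex" where
  "g2_integrand \<alpha> t =
     (if \<alpha> = 0 then exp (t ^ 3 / 3)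
      else ((1 + of_real (sqrt \<alpha>) * t ^ 3) / (1 - of_real (sqrt \<alpha>) * t ^ 3))
             powr of_real (1 / (6 * sqrt \<alpha>)))"

definition g2 :: "real \<Rightarrow> complex \<Rightarrow> complex" where
  "g2 \<alpha> z = contour_integral (linepath 0 z) (g2_integrand \<alpha>)"

end

theory Submission
  imports Defs
begin

text \<open>
  Write \<open>z f''/f' = F\<^sub>\<alpha>(z \<phi>(z))\<close> with \<open>\<phi> = c\<^sub>1 + c\<^sub>2 z + c\<^sub>3 z\<^sup>2 + \<dots>\<close> bounded by 1. Comparing
  coefficients gives \<open>2 a\<^sub>2 = c\<^sub>1\<close>, \<open>6 a\<^sub>3 = c\<^sub>2 + c\<^sub>1\<^sup>2\<close> and
  \<open>12 a\<^sub>4 = c\<^sub>3 + 3/2 c\<^sub>1 c\<^sub>2 + \<nu> c\<^sub>1\<^sup>3\<close> with \<open>\<nu> = \<alpha> + 1/2\<close>. Two steps of the Schur algorithm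
  parametrise \<open>(c\<^sub>1, c\<^sub>2, c\<^sub>3)\<close>; after rotating to \<open>c\<^sub>1 \<ge> 0\<close>, the bound 1 for the cubic functional
  reduces, for \<open>1/2 \<le> \<nu> \<le> 1\<close>, to the nonnegativity of a binary quadratic form that is affine
  in \<open>\<nu>\<close>. For \<open>\<nu> > 1\<close> the excess \<open>(\<nu> - 1) c\<^sub>1\<^sup>3\<close> is estimated trivially. The extremal functions
  have \<open>\<phi> = 1\<close> and \<open>\<phi> = z\<^sup>2\<close>.
\<close>

unbundle no vec_syntax

section \<open>Coefficients of bounded functions\<close>

text \<open>Carries functional equations on the disc over to formal power series, where coefficients
  can be compared.\<close>

lemma has_fps_expansion_eqD:
  assumes "f has_fps_expansion F" "g has_fps_expansion G"
    and "\<And>z. z \<in> unit_disc \<Longrightarrow> f z = g z"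
  shows "F = G"
proof -
  have "eventually (\<lambda>z. z \<in> unit_disc) (nhds (0::complex))"
    by (intro eventually_nhds_in_open) auto
  then have "eventually (\<lambda>z. f z = g z) (nhds 0)"
    by eventually_elim (use assms(3) in auto)
  then have "f has_fps_expansion G"
    using assms(2) has_fps_expansion_cong[of f g G G] by blast
  then show ?thesis
    using assms(1) fps_expansion_unique_complex by blast
qed

lemma holomorphic_unit_disc_fps_expansion:
  "f holomorphic_on unit_disc \<Longrightarrow> f has_fps_expansion fps_expansion f 0"
  by (rule has_fps_expansion_fps_expansion[of unit_disc]) auto

text \<open>By the Schwarz lemma, |\<omega>(z)| \<le> |z| bounds the quotient away from 0 and
  |\<omega>'(0)| \<le> 1 bounds it at 0.\<close>

lemma schwarz_quotient:
  assumes "\<omega> holomorphic_on unit_disc" "\<omega> 0 = 0" "\<And>z. z \<in> unit_disc \<Longrightarrow> norm (\<omega> z) < 1"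
  obtains h where "h holomorphic_on unit_disc" "\<And>z. z \<in> unit_disc \<Longrightarrow> \<omega> z = z * h z"
    "\<And>z. z \<in> unit_disc \<Longrightarrow> norm (h z) \<le> 1"
proof -
  obtain h where h: "h holomorphic_on unit_disc" "\<And>z. norm z < 1 \<Longrightarrow> \<omega> z = z * h z"
    "deriv \<omega> 0 = h 0"
    using Schwarz3[OF assms(1,2)] by blast
  have "norm (h z) \<le> 1" if "z \<in> unit_disc" for z
  proof (cases "z = 0")
    case True
    then show ?thesis
      using Schwarz_Lemma(2)[OF assms(1,2), of 0] assms(3) h(3) by simp
  next
    case False
    have "norm (\<omega> z) \<le> norm z"
      using Schwarz_Lemma(1)[OF assms(1,2), of z] assms(3) that by simp
    then have "norm z * norm (h z) \<le> norm z * 1"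
      using h(2)[of z] that by (simp add: norm_mult)
    then show ?thesis
      using False mult_le_cancel_left_pos[of "norm z"] by simp
  qed
  then show ?thesis
    using that h by simp
qed

text \<open>If \<open>\<phi>\<close> is a unimodular constant, then \<open>h = 0\<close> is the witness.\<close>

lemma schur_step:
  fixes \<phi> :: "complex \<Rightarrow> complex"
  assumes hol: "\<phi> holomorphic_on unit_disc" and le: "\<And>z. z \<in> unit_disc \<Longrightarrow> norm (\<phi> z) \<le> 1"
  obtains h where "h holomorphic_on unit_disc" "\<And>z. z \<in> unit_disc \<Longrightarrow> norm (h z) \<le> 1"
    "\<And>z. z \<in> unit_disc \<Longrightarrow> \<phi> z - \<phi> 0 = z * h z * (1 - cnj (\<phi> 0) * \<phi> z)"
proof (cases "\<exists>\<xi>\<in>unit_disc. norm (\<phi> \<xi>) = 1")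
  case True
  then obtain \<xi> where \<xi>: "\<xi> \<in> unit_disc" "norm (\<phi> \<xi>) = 1"
    by blast
  have "\<phi> constant_on unit_disc"
    using maximum_modulus_principle[OF hol, of unit_disc \<xi>] \<xi> le by simp
  then obtain k where "\<And>z. z \<in> unit_disc \<Longrightarrow> \<phi> z = k"
    unfolding constant_on_def by blast
  then show ?thesis
    using that[of "\<lambda>_. 0"] by simp
next
  case False
  then have lt: "norm (\<phi> z) < 1" if "z \<in> unit_disc" for z
    using le[OF that] that by (auto simp: order_le_less)
  have lt0: "norm (\<phi> 0) < 1"
    using lt by simp
  \<comment> \<open>The disc automorphism taking \<open>\<phi> 0\<close> to 0 makes the Schwarz
    lemma applicable; the quotient of \<open>\<psi>\<close> by z is the next Schur iterate.\<close>
  define \<psi> where "\<psi> = Moebius_function 0 (\<phi> 0) \<circ> \<phi>"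
  have 1: "\<psi> holomorphic_on unit_disc"
    unfolding \<psi>_def
    by (rule holomorphic_on_compose_gen[OF hol Moebius_function_holomorphic[OF lt0]])
      (use lt in auto)
  have 2: "\<psi> 0 = 0"
    by (simp add: \<psi>_def Moebius_function_eq_zero)
  have 3: "norm (\<psi> z) < 1" if "z \<in> unit_disc" for z
    using Moebius_function_norm_lt_1[OF lt0 lt[OF that]] by (simp add: \<psi>_def)
  obtain h where h: "h holomorphic_on unit_disc" "\<And>z. z \<in> unit_disc \<Longrightarrow> \<psi> z = z * h z"
    "\<And>z. z \<in> unit_disc \<Longrightarrow> norm (h z) \<le> 1"
    using schwarz_quotient[OF 1 2 3] by blast
  have "\<phi> z - \<phi> 0 = z * h z * (1 - cnj (\<phi> 0) * \<phi> z)" if "z \<in> unit_disc" for z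
  proof -
    have "norm (cnj (\<phi> 0) * \<phi> z) < 1 * 1"
      unfolding norm_mult using lt[OF that] lt0 by (intro mult_strict_mono') auto
    then have "cnj (\<phi> 0) * \<phi> z \<noteq> 1"
      by (metis mult_1 norm_one order_less_irrefl)
    then have "1 - cnj (\<phi> 0) * \<phi> z \<noteq> 0"
      by (metis eq_iff_diff_eq_0)
    then have "\<phi> z - \<phi> 0 = \<psi> z * (1 - cnj (\<phi> 0) * \<phi> z)"
      by (simp add: \<psi>_def Moebius_function_simple)
    then show ?thesis
      using h(2) that by simp
  qed
  then show ?thesis
    using that h by blast
qed

text \<open>Coefficients of z and z^2 in the Schur identity. The factor z lowers the index by one on
  the right, and 1 - |P_0|^2 is the constant term of 1 - cnj(P_0) P.\<close>

lemma schur_step_coeffs: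
  fixes \<phi> h :: "complex \<Rightarrow> complex"
  assumes "\<phi> has_fps_expansion P" "h has_fps_expansion H"
    and "\<And>z. z \<in> unit_disc \<Longrightarrow> \<phi> z - \<phi> 0 = z * h z * (1 - cnj (\<phi> 0) * \<phi> z)"
  shows "P $ 1 = (1 - (norm (P $ 0))\<^sup>2) * H $ 0"
    and "P $ 2 = (1 - (norm (P $ 0))\<^sup>2) * H $ 1 - cnj (P $ 0) * H $ 0 * P $ 1"
proof -
  have 0: "\<phi> 0 = P $ 0"
    using assms(1) by (rule has_fps_expansion_imp_0_eq_fps_nth_0)
  have "P - fps_const (P $ 0) = fps_X * H * (1 - fps_const (cnj (P $ 0)) * P)"
    by (rule has_fps_expansion_eqD[OF _ _ assms(3)[unfolded 0]])
      (rule assms(1,2) fps_expansion_intros)+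
  then have "(P - fps_const (P $ 0)) $ n
      = (fps_X * (H * (1 - fps_const (cnj (P $ 0)) * P))) $ n" for n
    by (simp add: mult.assoc)
  from this[of 1] this[of 2]
  show "P $ 1 = (1 - (norm (P $ 0))\<^sup>2) * H $ 0"
    and "P $ 2 = (1 - (norm (P $ 0))\<^sup>2) * H $ 1 - cnj (P $ 0) * H $ 0 * P $ 1"
    by (simp_all add: fps_mult_nth[of H] complex_norm_square[unfolded of_real_power] algebra_simps)
qed

text \<open>The parameters x and y are the values at 0 of the first and second Schur iterates.
  Nothing is divided by 1 - |P_0|^2, so the degenerate case |P_0| = 1 is included.\<close>

lemma bounded_coeffs_schur_parameters:
  fixes \<phi> :: "complex \<Rightarrow> complex"
  assumes hol: "\<phi> holomorphic_on unit_disc" and le: "\<And>z. z \<in> unit_disc \<Longrightarrow> norm (\<phi> z) \<le> 1"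
    and P: "\<phi> has_fps_expansion P"
  obtains x y :: complex where "norm x \<le> 1" "norm y \<le> 1"
    "P $ 1 = (1 - (norm (P $ 0))\<^sup>2) * x"
    "P $ 2 = (1 - (norm (P $ 0))\<^sup>2) * ((1 - (norm x)\<^sup>2) * y - cnj (P $ 0) * x\<^sup>2)"
proof -
  obtain h where h: "h holomorphic_on unit_disc" "\<And>z. z \<in> unit_disc \<Longrightarrow> norm (h z) \<le> 1"
    "\<And>z. z \<in> unit_disc \<Longrightarrow> \<phi> z - \<phi> 0 = z * h z * (1 - cnj (\<phi> 0) * \<phi> z)"
    using schur_step[OF hol le] by blast
  obtain k where k: "k holomorphic_on unit_disc" "\<And>z. z \<in> unit_disc \<Longrightarrow> norm (k z) \<le> 1"
    "\<And>z. z \<in> unit_disc \<Longrightarrow> h z - h 0 = z * k z * (1 - cnj (h 0) * h z)"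
    using schur_step[OF h(1,2)] by blast
  note eh = holomorphic_unit_disc_fps_expansion[OF h(1)]
    and ek = holomorphic_unit_disc_fps_expansion[OF k(1)]
  note P' = schur_step_coeffs[OF P eh h(3)] and H' = schur_step_coeffs(1)[OF eh ek k(3)]
  have h0: "fps_expansion h 0 $ 0 = h 0" and k0: "fps_expansion k 0 $ 0 = k 0"
    by (simp_all add: fps_expansion_def)
  have H1: "fps_expansion h 0 $ Suc 0 = (1 - (norm (h 0))\<^sup>2) * k 0"
    using H' unfolding h0 k0 by simp
  show ?thesis
  proof (rule that[of "h 0" "k 0"])
    show "norm (h 0) \<le> 1" "norm (k 0) \<le> 1"
      using h(2) k(2) by simp_all
    show 1: "P $ 1 = (1 - (norm (P $ 0))\<^sup>2) * h 0"
      using P'(1) unfolding h0 .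
    show "P $ 2 = (1 - (norm (P $ 0))\<^sup>2) * ((1 - (norm (h 0))\<^sup>2) * k 0 - cnj (P $ 0) * (h 0)\<^sup>2)"
      using P'(2) unfolding 1 h0 k0 by (simp add: H1 algebra_simps power2_eq_square)
  qed
qed

section \<open>The cubic coefficient functional\<close>

text \<open>For fixed u this is a quadratic form in (s, R) that is affine in \<nu>, hence a convex
  combination of the forms at \<nu> = 1/2 and \<nu> = 1; it suffices to treat these two.\<close>

lemma cubic_discriminant:
  fixes u s R \<nu> :: real
  assumes "0 \<le> s" "0 \<le> R" "1/2 \<le> \<nu>" "\<nu> \<le> 1" "-1 \<le> u"
  shows "0 \<le> s\<^sup>2 + (3*u - 1/4) * s * R + (1 - 3*\<nu>*u + 4*\<nu>*u\<^sup>2) * R\<^sup>2"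
proof -
  define L where "L \<mu> = s\<^sup>2 + (3*u - 1/4) * s * R + (1 - 3*\<mu>*u + 4*\<mu>*u\<^sup>2) * R\<^sup>2" for \<mu>
  \<comment> \<open>Completing the square in s leaves a coefficient of R^2 that is itself a multiple
    of a square, namely of (u - 3/4)^2.\<close>
  have "L 1 = (s + (3*u - 1/4) / 2 * R)\<^sup>2 + 7/4 * ((u - 3/4) * R)\<^sup>2"
    by (simp add: L_def power2_eq_square field_simps)
  then have 1: "0 \<le> L 1"
    by simp
  have 2: "0 \<le> L (1/2)"
  \<comment> \<open>The cross coefficient 3u - 1/4 vanishes at 1/12. Above it every term is
    nonnegative because s, R \<ge> 0. Below it the square is completed, which would fail for u >
    3/4.\<close>
  proof (cases "u \<ge> 1/12")
    case True
    have "1 - 3*(1/2)*u + 4*(1/2)*u\<^sup>2 = 2 * (u - 3/8)\<^sup>2 + 23/32"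
      by (simp add: power2_eq_square field_simps)
    then have "0 \<le> (1 - 3*(1/2)*u + 4*(1/2)*u\<^sup>2) * R\<^sup>2"
      by simp
    moreover have "0 \<le> s\<^sup>2 + (3*u - 1/4) * s * R"
      using True assms by (intro add_nonneg_nonneg mult_nonneg_nonneg) auto
    ultimately show ?thesis
      unfolding L_def by linarith
  next
    case False
    have "L (1/2) = (s + (3*u - 1/4) / 2 * R)\<^sup>2 + (u + 21/4) * (3/4 - u) / 4 * R\<^sup>2"
      by (simp add: L_def power2_eq_square field_simps)
    moreover have "0 \<le> (u + 21/4) * (3/4 - u)"
      using False assms by (intro mult_nonneg_nonneg) auto
    then have "0 \<le> (s + (3*u - 1/4) / 2 * R)\<^sup>2 + (u + 21/4) * (3/4 - u) / 4 * R\<^sup>2"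
      by simp
    ultimately show ?thesis
      by simp
  qed
  have "L \<nu> = (2*\<nu> - 1) * L 1 + (2 - 2*\<nu>) * L (1/2)"
    by (simp add: L_def field_simps)
  also have "\<dots> \<ge> 0"
    using 1 2 assms by (intro add_nonneg_nonneg mult_nonneg_nonneg) auto
  finally show ?thesis
    by (simp add: L_def)
qed

text \<open>The case c = r of the functional without its y-term. The right-hand side is 1 - (1 -
  r^2)(1 - |x|^2), which is what the estimate of the y-term leaves of the bound 1.\<close>

lemma cubic_functional_real:
  fixes r \<nu> :: real and x :: complex
  assumes "0 \<le> r" "r \<le> 1" "norm x \<le> 1" "1/2 \<le> \<nu>" "\<nu> \<le> 1"
  shows "r * norm ((1 - r\<^sup>2) * (3/2 * x - x\<^sup>2) + \<nu> * r\<^sup>2) \<le> r\<^sup>2 + (1 - r\<^sup>2) * (norm x)\<^sup>2"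
proof (rule power2_le_imp_le)
  \<comment> \<open>In this notation the right-hand side becomes R + s.\<close>
  define u v R s where "u = Re x" and "v = Im x" and "R = r\<^sup>2"
    and "s = (1 - R) * (u\<^sup>2 + v\<^sup>2)"
  have R: "0 \<le> R" "R \<le> 1"
    using assms by (auto simp: R_def power_le_one)
  have s: "0 \<le> s"
    using R by (simp add: s_def)
  have u: "-1 \<le> u"
    using abs_Re_le_cmod[of x] assms(3) by (simp add: u_def)
  have nx: "(norm x)\<^sup>2 = u\<^sup>2 + v\<^sup>2"
    by (simp add: cmod_power2 u_def v_def)
  have "(norm ((1 - r\<^sup>2) * (3/2 * x - x\<^sup>2) + \<nu> * r\<^sup>2))\<^sup>2
      = ((1 - R) * (3/2 * u - (u\<^sup>2 - v\<^sup>2)) + \<nu> * R)\<^sup>2 + ((1 - R) * (3/2 * v - 2 * u * v))\<^sup>2"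
    by (simp add: cmod_power2 u_def v_def R_def flip: of_real_power)
      (simp add: power2_eq_square mult_ac)
  then have "(r * norm ((1 - r\<^sup>2) * (3/2 * x - x\<^sup>2) + \<nu> * r\<^sup>2))\<^sup>2
      = R * (((1 - R) * (3/2 * u - (u\<^sup>2 - v\<^sup>2)) + \<nu> * R)\<^sup>2 + ((1 - R) * (3/2 * v - 2 * u * v))\<^sup>2)"
    by (simp add: power_mult_distrib R_def)
  \<comment> \<open>The difference of the squared sides is 1 - R times the form from
    \<open>cubic_discriminant\<close>, plus a remainder that vanishes at \<nu> = 1 and is
    nonnegative for 1/2 \<le> \<nu> \<le> 1.\<close>
  moreover have "(R + s)\<^sup>2
      - R * (((1 - R) * (3/2 * u - (u\<^sup>2 - v\<^sup>2)) + \<nu> * R)\<^sup>2 + ((1 - R) * (3/2 * v - 2 * u * v))\<^sup>2)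
      = (1 - R) * (s\<^sup>2 + (3*u - 1/4) * s * R + (1 - 3*\<nu>*u + 4*\<nu>*u\<^sup>2) * R\<^sup>2)
        + (R^3 * (1 - \<nu>\<^sup>2) + 2 * (1 - \<nu>) * R\<^sup>2 * s)"
    unfolding s_def by (simp add: field_simps) algebra
  moreover have "0 \<le> (1 - R) * (s\<^sup>2 + (3*u - 1/4) * s * R + (1 - 3*\<nu>*u + 4*\<nu>*u\<^sup>2) * R\<^sup>2)"
    using cubic_discriminant[OF s R(1) assms(4,5) u] R(2) by (intro mult_nonneg_nonneg) auto
  moreover have "0 \<le> R^3 * (1 - \<nu>\<^sup>2) + 2 * (1 - \<nu>) * R\<^sup>2 * s"
    using R s assms by (intro add_nonneg_nonneg mult_nonneg_nonneg) (auto simp: power_le_one)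
  ultimately show "(r * norm ((1 - r\<^sup>2) * (3/2 * x - x\<^sup>2) + \<nu> * r\<^sup>2))\<^sup>2
      \<le> (r\<^sup>2 + (1 - r\<^sup>2) * (norm x)\<^sup>2)\<^sup>2"
    by (simp add: nx flip: R_def s_def)
  show "0 \<le> r\<^sup>2 + (1 - r\<^sup>2) * (norm x)\<^sup>2"
    unfolding nx using R s by (simp flip: R_def s_def)
qed

lemma norm_one_minus_of_real_square:
  assumes "0 \<le> r" "r \<le> 1"
  shows "norm (1 - (complex_of_real r)\<^sup>2) = 1 - r\<^sup>2"
proof -
  have "norm (complex_of_real (1 - r\<^sup>2)) = 1 - r\<^sup>2"
    unfolding norm_of_real using assms by (simp add: power_le_one)
  then show ?thesis
    by simp
qed

text \<open>A rotation reduces the part without y to c = r \<ge> 0. The y-term is at most (1 -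
  r^2)(1 - |x|^2), and the two bounds add up to exactly 1.\<close>

lemma cubic_functional_le_1:
  fixes c x y :: complex and \<nu> :: real
  assumes c: "norm c \<le> 1" and x: "norm x \<le> 1" and y: "norm y \<le> 1" and \<nu>: "1/2 \<le> \<nu>" "\<nu> \<le> 1"
  defines "q \<equiv> complex_of_real (1 - (norm c)\<^sup>2)"
  shows "norm (q * ((1 - (norm x)\<^sup>2) * y - cnj c * x\<^sup>2) + 3/2 * c * (q * x) + \<nu> * c^3) \<le> 1"
proof -
  \<comment> \<open>The case distinction keeps \<open>e\<close> unimodular for c = 0, where
    \<open>sgn c\<close> would be 0.\<close>
  define r e where "r = norm c" and "e = (if c = 0 then 1 else sgn c)"
  have r: "0 \<le> r" "r \<le> 1"
    using c by (auto simp: r_def)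
  have e: "norm e = 1" "c = r * e"
    by (auto simp: e_def r_def norm_sgn) (simp add: sgn_div_norm scaleR_conv_of_real)
  then have ee: "e * cnj e = 1"
    by (metis complex_norm_square of_real_1 one_power2)
  \<comment> \<open>With c = r e and x = x' e^2, the terms c x, cnj(c) x^2 and c^3 all carry the
    same factor e^3.\<close>
  define x' where "x' = x * (cnj e)\<^sup>2"
  have x': "x = x' * e\<^sup>2" "norm x' = norm x"
    using e(1) ee by (simp_all add: x'_def norm_mult norm_power flip: power_mult_distrib)
      (simp add: mult.assoc mult.commute[of "cnj e"] flip: power_mult_distrib)
  have q: "q = 1 - r\<^sup>2"
    by (simp add: q_def r_def)
  have q0: "0 \<le> 1 - r\<^sup>2"
    using r by (simp add: power_le_one)
  have "q * (3/2 * c * x - cnj c * x\<^sup>2) + \<nu> * c^3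
      = e^3 * (r * ((1 - r\<^sup>2) * (3/2 * x' - x'\<^sup>2) + \<nu> * r\<^sup>2))"
    unfolding q e(2) x'(1) using ee
    by (simp add: field_simps) algebra
  then have "norm (q * (3/2 * c * x - cnj c * x\<^sup>2) + \<nu> * c^3)
      = r * norm ((1 - r\<^sup>2) * (3/2 * x' - x'\<^sup>2) + \<nu> * r\<^sup>2)"
    using r e(1) by (simp add: norm_mult norm_power)
  also have "\<dots> \<le> r\<^sup>2 + (1 - r\<^sup>2) * (norm x)\<^sup>2"
    using cubic_functional_real[of r x' \<nu>] r x \<nu> x'(2) by simp
  finally have 1: "norm (q * (3/2 * c * x - cnj c * x\<^sup>2) + \<nu> * c^3)
      \<le> r\<^sup>2 + (1 - r\<^sup>2) * (norm x)\<^sup>2" .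
  have "norm (q * ((1 - (norm x)\<^sup>2) * y)) = (1 - r\<^sup>2) * ((1 - (norm x)\<^sup>2) * norm y)"
    using r x unfolding q by (simp add: norm_mult norm_one_minus_of_real_square)
  also have "\<dots> \<le> (1 - r\<^sup>2) * ((1 - (norm x)\<^sup>2) * 1)"
    using q0 x y by (intro mult_left_mono) (auto simp: power_le_one)
  finally have 2: "norm (q * ((1 - (norm x)\<^sup>2) * y)) \<le> (1 - r\<^sup>2) * (1 - (norm x)\<^sup>2)"
    by simp
  have "q * ((1 - (norm x)\<^sup>2) * y - cnj c * x\<^sup>2) + 3/2 * c * (q * x) + \<nu> * c^3
      = q * ((1 - (norm x)\<^sup>2) * y) + (q * (3/2 * c * x - cnj c * x\<^sup>2) + \<nu> * c^3)"
    by (simp add: algebra_simps)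
  then show ?thesis
    using norm_triangle_mono[OF 2 1] by (simp add: algebra_simps)
qed

section \<open>Coefficients in the class \<open>\<B>\<K>(\<alpha>)\<close>\<close>

lemma denominator_nonzero:
  assumes "0 \<le> \<alpha>" "\<alpha> \<le> 1" "w \<in> unit_disc" "n > 0"
  shows "1 - complex_of_real \<alpha> * w ^ n \<noteq> 0"
proof
  assume "1 - complex_of_real \<alpha> * w ^ n = 0"
  then have "\<alpha> * norm w ^ n = 1"
    using assms(1) by (metis abs_of_nonneg eq_iff_diff_eq_0 norm_mult norm_of_real norm_one norm_power)
  moreover have "norm w ^ n < 1"
    using assms(3,4) by (simp add: power_less_one_iff)
  moreover have "\<alpha> * norm w ^ n \<le> 1 * norm w ^ n"
    using assms(2) by (intro mult_right_mono) auto
  ultimately show False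
    by simp
qed

lemma class_A_nth:
  assumes "f \<in> class_A" "f has_fps_expansion A"
  shows "A $ 0 = 0" "A $ 1 = 1"
  using assms fps_nth_fps_expansion[OF assms(2), of 0] fps_nth_fps_expansion[OF assms(2), of 1]
  by (auto simp: class_A_def)

text \<open>Clearing denominators gives (1 - \<alpha> z^2 \<phi>^2) f'' = f' \<phi>, a recursion for
  the coefficients of f. It serves both arbitrary members of the class and the extremal
  functions.\<close>

lemma class_BK_coeffs:
  assumes \<alpha>: "0 \<le> \<alpha>" "\<alpha> \<le> 1" and f: "f \<in> class_A" "\<And>z. z \<in> unit_disc \<Longrightarrow> deriv f z \<noteq> 0"
    and \<omega>: "\<And>z. z \<in> unit_disc \<Longrightarrow> z * deriv (deriv f) z / deriv f z = F_fun \<alpha> (z * \<phi> z)"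
      "\<And>z. z \<in> unit_disc \<Longrightarrow> z * \<phi> z \<in> unit_disc"
    and A: "f has_fps_expansion A" and P: "\<phi> has_fps_expansion P"
  shows "2 * A $ 2 = P $ 0" "6 * A $ 3 = P $ 1 + (P $ 0)\<^sup>2"
    "12 * A $ 4 = P $ 2 + 3/2 * P $ 0 * P $ 1 + of_real (\<alpha> + 1/2) * (P $ 0) ^ 3"
proof -
  have ode: "z * ((1 - of_real \<alpha> * (z * \<phi> z)^2) * deriv (deriv f) z) = z * (deriv f z * \<phi> z)"
    if "z \<in> unit_disc" for z
  proof -
    have "1 - of_real \<alpha> * (z * \<phi> z)^2 \<noteq> 0"
      using denominator_nonzero[OF \<alpha> \<omega>(2)[OF that], of 2] by simp
    then show ?thesis
      using \<omega>(1)[OF that] f(2)[OF that] by (simp add: F_fun_def divide_simps mult_ac)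
  qed
  have "fps_X * ((1 - fps_const (of_real \<alpha>) * (fps_X * P)^2) * fps_deriv (fps_deriv A))
      = fps_X * (fps_deriv A * P)"
    by (rule has_fps_expansion_eqD[OF _ _ ode]) (rule A P fps_expansion_intros)+
  \<comment> \<open>At z = 0 the identity of functions only says 0 = 0; the factor z is cancelled
    among power series instead.\<close>
  then have "(1 - fps_const (of_real \<alpha>) * (fps_X * P)^2) * fps_deriv (fps_deriv A) = fps_deriv A * P"
    by (simp only: mult_cancel_left fps_X_neq_zero simp_thms)
  \<comment> \<open>With two explicit factors \<open>fps_X\<close>, the \<alpha>-term first enters
    at coefficient 2, that is, in the equation for \<open>A $ 4\<close>.\<close>
  moreover have "fps_const (of_real \<alpha>) * (fps_X * P)^2 * fps_deriv (fps_deriv A)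
      = fps_X * (fps_X * (fps_const (of_real \<alpha>) * (P^2 * fps_deriv (fps_deriv A))))"
    by (simp only: power2_eq_square mult_ac)
  ultimately have "fps_deriv (fps_deriv A)
      = fps_deriv A * P + fps_X * (fps_X * (fps_const (of_real \<alpha>) * (P^2 * fps_deriv (fps_deriv A))))"
    by (metis add.commute diff_eq_eq left_diff_distrib mult_1)
  then have eq: "fps_deriv (fps_deriv A) $ n
      = (fps_deriv A * P + fps_X * (fps_X * (fps_const (of_real \<alpha>) * (P^2 * fps_deriv (fps_deriv A))))) $ n" for n
    by (rule arg_cong)
  note A01 = class_A_nth[OF f(1) A]
  have 0: "2 * A $ 2 = P $ 0"
    using eq[of 0] A01 by (simp add: numeral_2_eq_2)
  have 1: "6 * A $ 3 = P $ 1 + 2 * A $ 2 * P $ 0"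
    using eq[of 1] A01 by (simp add: fps_mult_nth eval_nat_numeral algebra_simps)
  have 2: "12 * A $ 4 = P $ 2 + 2 * A $ 2 * P $ 1 + 3 * A $ 3 * P $ 0 + 2 * of_real \<alpha> * (P $ 0)\<^sup>2 * A $ 2"
    using eq[of 2] A01
    by (simp add: fps_mult_nth eval_nat_numeral power2_eq_square algebra_simps)
  show "2 * A $ 2 = P $ 0" by fact
  show a3: "6 * A $ 3 = P $ 1 + (P $ 0)\<^sup>2"
    using 1 unfolding 0 by (simp add: power2_eq_square)
  have e3: "A $ 3 = (P $ 1 + (P $ 0)\<^sup>2) / 6"
    using a3 by (simp add: field_simps)
  have e2: "A $ 2 = P $ 0 / 2"
    using 0 by (simp add: field_simps)
  show "12 * A $ 4 = P $ 2 + 3/2 * P $ 0 * P $ 1 + of_real (\<alpha> + 1/2) * (P $ 0) ^ 3"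
    unfolding 2 e2 e3 by (simp add: field_simps power2_eq_square power3_eq_cube)
qed

lemma has_normalized_expansion_imp_fps:
  assumes "has_normalized_expansion f a"
  obtains A where "f has_fps_expansion A" "A $ 2 = a 2" "A $ 3 = a 3" "A $ 4 = a 4"
proof
  \<comment> \<open>The expansion leaves \<open>a 0\<close> and \<open>a 1\<close> arbitrary, so the
    series takes the values 0 and 1 there; these restore the summand z.\<close>
  let ?A = "Abs_fps (\<lambda>n. if n = 0 then 0 else if n = 1 then 1 else a n)"
  have "(\<lambda>n. ?A $ n * z ^ n) sums f z" if "z \<in> unit_disc" for z
  proof -
    have "(\<lambda>n. ?A $ (n + 2) * z ^ (n + 2)) sums (f z - z)"
      using assms that by (simp add: has_normalized_expansion_def)
    then have "(\<lambda>n. ?A $ n * z ^ n) sums (f z - z + (\<Sum>n<2. ?A $ n * z ^ n))"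
      using sums_iff_shift[of "\<lambda>n. ?A $ n * z ^ n" 2] by blast
    then show ?thesis
      by (simp add: numeral_2_eq_2)
  qed
  moreover have "eventually (\<lambda>z. z \<in> unit_disc) (nhds (0::complex))"
    by (intro eventually_nhds_in_open) auto
  ultimately have "eventually (\<lambda>z. (\<lambda>n. ?A $ n * z ^ n) sums f z) (nhds 0)"
    by (auto elim: eventually_mono)
  then show "f has_fps_expansion ?A"
    by (rule has_fps_expansionI)
qed auto

lemma class_A_has_normalized_expansion:
  assumes "f \<in> class_A"
  shows "has_normalized_expansion f (fps_nth (fps_expansion f 0))"
  unfolding has_normalized_expansion_def
proof
  fix z :: complex assume "z \<in> unit_disc"
  then have "(\<lambda>n. fps_expansion f 0 $ n * z ^ n) sums f z"
    using holomorphic_power_series[of f 0 1 z] assms by (simp add: class_A_def fps_expansion_def)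
  then have "(\<lambda>n. fps_expansion f 0 $ (n + 2) * z ^ (n + 2))
      sums (f z - (\<Sum>n<2. fps_expansion f 0 $ n * z ^ n))"
    using sums_iff_shift[of "\<lambda>n. fps_expansion f 0 $ n * z ^ n" 2] by simp
  moreover have "(\<Sum>n<2. fps_expansion f 0 $ n * z ^ n) = z"
    using assms by (simp add: numeral_2_eq_2 fps_expansion_def class_A_def)
  ultimately show "(\<lambda>n. fps_expansion f 0 $ (n + 2) * z ^ (n + 2)) sums (f z - z)"
    by simp
qed

lemma class_BK_coeff_bounds:
  assumes \<alpha>: "0 \<le> \<alpha>" "\<alpha> \<le> 1" and f: "f \<in> class_BK \<alpha>" and a: "has_normalized_expansion f a"
  shows "norm (a 2) \<le> 1/2" "norm (a 3) \<le> 1/6"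
    "\<alpha> \<le> 1/2 \<Longrightarrow> norm (a 4) \<le> 1/12" "1/2 \<le> \<alpha> \<Longrightarrow> norm (a 4) \<le> (1 + 2 * \<alpha>) / 24"
proof -
  obtain A where A: "f has_fps_expansion A" "A $ 2 = a 2" "A $ 3 = a 3" "A $ 4 = a 4"
    using has_normalized_expansion_imp_fps[OF a] .
  obtain \<omega> where \<omega>: "\<omega> holomorphic_on unit_disc" "\<omega> ` unit_disc \<subseteq> unit_disc" "\<omega> 0 = 0"
    "\<forall>z\<in>unit_disc. z * deriv (deriv f) z / deriv f z = F_fun \<alpha> (\<omega> z)"
    using f unfolding class_BK_def subordinate_def by blast
  have "\<And>z. z \<in> unit_disc \<Longrightarrow> norm (\<omega> z) < 1"
    using \<omega>(2) by fastforce
  then obtain \<phi> where \<phi>: "\<phi> holomorphic_on unit_disc" "\<And>z. z \<in> unit_disc \<Longrightarrow> \<omega> z = z * \<phi> z"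
    "\<And>z. z \<in> unit_disc \<Longrightarrow> norm (\<phi> z) \<le> 1"
    using schwarz_quotient[OF \<omega>(1,3)] by blast
  define P where "P = fps_expansion \<phi> 0"
  have P: "\<phi> has_fps_expansion P"
    unfolding P_def by (rule holomorphic_unit_disc_fps_expansion[OF \<phi>(1)])
  have fA: "f \<in> class_A" and fnz: "\<And>z. z \<in> unit_disc \<Longrightarrow> deriv f z \<noteq> 0"
    using f by (auto simp: class_BK_def)
  have eq: "z * deriv (deriv f) z / deriv f z = F_fun \<alpha> (z * \<phi> z)" "z * \<phi> z \<in> unit_disc"
    if "z \<in> unit_disc" for z
    using \<omega>(4) image_subset_iff[THEN iffD1, OF \<omega>(2)] that unfolding \<phi>(2)[OF that, symmetric]
    by auto
  note co = class_BK_coeffs[OF \<alpha> fA fnz eq A(1) P, unfolded A(2-4)]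
  obtain x y :: complex where xy: "norm x \<le> 1" "norm y \<le> 1" "P $ 1 = (1 - (norm (P $ 0))\<^sup>2) * x"
    "P $ 2 = (1 - (norm (P $ 0))\<^sup>2) * ((1 - (norm x)\<^sup>2) * y - cnj (P $ 0) * x\<^sup>2)"
    using bounded_coeffs_schur_parameters[OF \<phi>(1,3) P] .
  define c where "c = P $ 0"
  have c: "norm c \<le> 1"
    using \<phi>(3)[of 0] by (simp add: c_def P_def fps_expansion_def)
  have "2 * norm (a 2) = norm c"
    using arg_cong[OF co(1), of norm] by (simp add: norm_mult c_def)
  then show "norm (a 2) \<le> 1/2"
    using c by simp
  have c2: "(norm c)\<^sup>2 \<le> 1"
    using c by (simp add: power_le_one)
  \<comment> \<open>The bound |P_1| \<le> 1 - |c|^2 leaves exactly |c|^2 for the term c^2.\<close>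
  have "norm (P $ 1) = (1 - (norm c)\<^sup>2) * norm x"
    using c unfolding xy(3) by (simp add: norm_mult norm_one_minus_of_real_square flip: c_def)
  also have "\<dots> \<le> (1 - (norm c)\<^sup>2) * 1"
    using c2 xy(1) by (intro mult_left_mono) auto
  finally have "norm (P $ 1 + c\<^sup>2) \<le> 1"
    using norm_triangle_ineq[of "P $ 1" "c\<^sup>2"] by (simp add: norm_power)
  moreover have "6 * norm (a 3) = norm (P $ 1 + c\<^sup>2)"
    using arg_cong[OF co(2), of norm] by (simp add: norm_mult c_def)
  ultimately show "norm (a 3) \<le> 1/6"
    by simp
  have cubic: "norm (P $ 2 + 3/2 * c * P $ 1 + of_real \<nu> * c ^ 3) \<le> 1" if "1/2 \<le> \<nu>" "\<nu> \<le> 1" for \<nu> :: real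
    using cubic_functional_le_1[OF c xy(1,2) that] unfolding xy(3,4) c_def by simp
  have a4: "12 * norm (a 4) = norm (P $ 2 + 3/2 * c * P $ 1 + of_real (\<alpha> + 1/2) * c ^ 3)"
    using arg_cong[OF co(3), of norm] by (simp add: norm_mult c_def)
  \<comment> \<open>Here \<nu> = \<alpha> + 1/2 lies in [1/2, 1].\<close>
  show "norm (a 4) \<le> 1/12" if "\<alpha> \<le> 1/2"
    using cubic[of "\<alpha> + 1/2"] a4 \<alpha> that by simp
  \<comment> \<open>Now \<nu> \<ge> 1, so \<nu> c^3 is split into c^3 and (\<alpha> - 1/2) c^3,
    giving 12 |a_4| \<le> 1 + (\<alpha> - 1/2).\<close>
  show "norm (a 4) \<le> (1 + 2 * \<alpha>) / 24" if "1/2 \<le> \<alpha>"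
  proof -
    have "norm c ^ 3 \<le> 1"
      using c by (simp add: power_le_one)
    then have "(\<alpha> - 1/2) * norm c ^ 3 \<le> (\<alpha> - 1/2) * 1"
      using that by (intro mult_left_mono) auto
    then have "norm (of_real (\<alpha> - 1/2) * c ^ 3) \<le> \<alpha> - 1/2"
      using that unfolding norm_mult norm_power norm_of_real by simp
    moreover have "P $ 2 + 3/2 * c * P $ 1 + of_real (\<alpha> + 1/2) * c ^ 3
        = (P $ 2 + 3/2 * c * P $ 1 + of_real 1 * c ^ 3) + of_real (\<alpha> - 1/2) * c ^ 3"
      by (simp add: algebra_simps)
    ultimately show ?thesis
      using norm_triangle_mono[OF cubic[of 1], of "of_real (\<alpha> - 1/2) * c ^ 3" "\<alpha> - 1/2"] a4
      by (simp add: field_simps)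
  qed
qed

section \<open>The extremal functions\<close>

text \<open>Convexity of the disc provides a primitive p, and the integral along the segment is p(z)
  - p(0).\<close>

lemma contour_integral_linepath_primitive:
  assumes "G holomorphic_on unit_disc" "z \<in> unit_disc"
  shows "((\<lambda>z. contour_integral (linepath 0 z) G) has_field_derivative G z) (at z)"
proof -
  obtain p where p: "\<And>x. x \<in> unit_disc \<Longrightarrow> (p has_field_derivative G x) (at x within unit_disc)"
    using holomorphic_convex_primitive'[OF convex_ball open_ball assms(1)] by blast
  have eq: "contour_integral (linepath 0 x) G = p x - p 0" if "x \<in> unit_disc" for x
    using contour_integral_primitive[of unit_disc p G "linepath 0 x"] p that
    by (intro contour_integral_unique) (simp add: closed_segment_subset)
  have "((\<lambda>x. p x - p 0) has_field_derivative G z) (at z)"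
    using p[OF assms(2)] assms(2) at_within_open[OF assms(2)]
    by (auto intro!: derivative_eq_intros)
  then show ?thesis
    by (rule has_field_derivative_transform_within_open[OF _ open_ball assms(2)]) (simp add: eq)
qed

lemma F_fun_holomorphic:
  assumes "0 \<le> \<alpha>" "\<alpha> \<le> 1"
  shows "F_fun \<alpha> holomorphic_on unit_disc"
  unfolding F_fun_def using denominator_nonzero[OF assms, of _ 2]
  by (intro holomorphic_intros) auto

text \<open>Here g' = G and g'' = G h, so z g''/g' = z h = F(z \<phi>) with Schwarz function z
  \<phi>(z). Prescribing \<phi> thus determines the first coefficients of g.\<close>

lemma extremal_function:
  assumes \<alpha>: "0 \<le> \<alpha>" "\<alpha> \<le> 1" and nz: "\<And>z. z \<in> unit_disc \<Longrightarrow> G z \<noteq> 0" and G0: "G 0 = 1"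
    and dG: "\<And>z. z \<in> unit_disc \<Longrightarrow> (G has_field_derivative G z * h z) (at z)"
    and h: "\<And>z. z \<in> unit_disc \<Longrightarrow> z * h z = F_fun \<alpha> (z * \<phi> z)"
    and \<phi>: "\<phi> holomorphic_on unit_disc" "\<And>z. z \<in> unit_disc \<Longrightarrow> norm (\<phi> z) \<le> 1"
  defines "g \<equiv> \<lambda>z. contour_integral (linepath 0 z) G"
  assumes P: "\<phi> has_fps_expansion P"
  shows "g \<in> class_BK \<alpha>"
    "\<exists>b. has_normalized_expansion g b \<and> 2 * b 2 = P $ 0 \<and> 6 * b 3 = P $ 1 + (P $ 0)\<^sup>2 \<and>
      12 * b 4 = P $ 2 + 3/2 * P $ 0 * P $ 1 + of_real (\<alpha> + 1/2) * (P $ 0) ^ 3"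
proof -
  have hol: "G holomorphic_on unit_disc"
    unfolding holomorphic_on_open[OF open_ball] using dG by blast
  note dg = contour_integral_linepath_primitive[OF hol, folded g_def]
  have d1: "deriv g z = G z" if "z \<in> unit_disc" for z
    using dg[OF that] by (rule DERIV_imp_deriv)
  have d2: "deriv (deriv g) z = G z * h z" if "z \<in> unit_disc" for z
  proof -
    have "(deriv g has_field_derivative G z * h z) (at z)"
      by (rule has_field_derivative_transform_within_open[OF dG[OF that] open_ball that])
        (simp add: d1)
    then show ?thesis
      by (rule DERIV_imp_deriv)
  qed
  have disc: "z * \<phi> z \<in> unit_disc" if "z \<in> unit_disc" for z
  proof -
    have "norm z * norm (\<phi> z) \<le> norm z * 1"
      using \<phi>(2)[OF that] by (intro mult_left_mono) auto
    then show ?thesis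
      using that by (simp add: norm_mult)
  qed
  have eq: "z * deriv (deriv g) z / deriv g z = F_fun \<alpha> (z * \<phi> z)" if "z \<in> unit_disc" for z
    using nz[OF that] h[OF that] that by (simp add: d1 d2)
  have "g holomorphic_on unit_disc"
    unfolding holomorphic_on_open[OF open_ball] using dg by blast
  then have g: "g \<in> class_A"
    using d1[of 0] G0 by (simp add: class_A_def) (simp add: g_def)
  have gnz: "deriv g z \<noteq> 0" if "z \<in> unit_disc" for z
    using nz that by (simp add: d1)
  have \<omega>: "(\<lambda>z. z * \<phi> z) holomorphic_on unit_disc"
    by (intro holomorphic_intros \<phi>)
  \<comment> \<open>The holomorphy of z g''/g' demanded by \<open>subordinate\<close> is inherited
    from this composition, with which it agrees on the disc.\<close>
  have "(F_fun \<alpha> \<circ> (\<lambda>z. z * \<phi> z)) holomorphic_on unit_disc"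
    by (rule holomorphic_on_compose_gen[OF \<omega> F_fun_holomorphic[OF \<alpha>]]) (use disc in auto)
  then have "(\<lambda>z. z * deriv (deriv g) z / deriv g z) holomorphic_on unit_disc"
    by (rule holomorphic_transform) (simp add: eq)
  then have "subordinate (\<lambda>z. z * deriv (deriv g) z / deriv g z) (F_fun \<alpha>)"
    unfolding subordinate_def using F_fun_holomorphic[OF \<alpha>] \<omega> disc eq
    by (intro conjI exI[of _ "\<lambda>z. z * \<phi> z"]) auto
  then show "g \<in> class_BK \<alpha>"
    using g gnz by (simp add: class_BK_def)
  have A: "g has_fps_expansion fps_expansion g 0"
    using g by (intro holomorphic_unit_disc_fps_expansion) (simp add: class_A_def)
  show "\<exists>b. has_normalized_expansion g b \<and> 2 * b 2 = P $ 0 \<and> 6 * b 3 = P $ 1 + (P $ 0)\<^sup>2 \<and>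
      12 * b 4 = P $ 2 + 3/2 * P $ 0 * P $ 1 + of_real (\<alpha> + 1/2) * (P $ 0) ^ 3"
    using class_A_has_normalized_expansion[OF g] class_BK_coeffs[OF \<alpha> g gnz eq disc A P] by blast
qed

lemma g1_extremal:
  assumes \<alpha>: "0 \<le> \<alpha>" "\<alpha> \<le> 1"
  shows "g1 \<alpha> \<in> class_BK \<alpha>"
    "\<exists>b. has_normalized_expansion (g1 \<alpha>) b \<and> b 2 = 1/2 \<and> b 3 = 1/6 \<and> b 4 = of_real (1 + 2 * \<alpha>) / 24"
proof -
  define q where "q = (\<lambda>t. 1 / (1 - complex_of_real \<alpha> * t ^ 2))"
  define H where "H = (\<lambda>u. contour_integral (linepath 0 u) q)"
  define G where "G = (\<lambda>u. exp (H u))"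
  have g1: "g1 \<alpha> = (\<lambda>z. contour_integral (linepath 0 z) G)"
    by (simp add: fun_eq_iff g1_def G_def H_def q_def)
  have "q holomorphic_on unit_disc"
    unfolding q_def using denominator_nonzero[OF \<alpha>, of _ 2] by (intro holomorphic_intros) auto
  then have dH: "(H has_field_derivative q z) (at z)" if "z \<in> unit_disc" for z
    unfolding H_def using that by (rule contour_integral_linepath_primitive)
  have "(G has_field_derivative G z * q z) (at z)" if "z \<in> unit_disc" for z
    unfolding G_def using dH[OF that] by (auto intro!: derivative_eq_intros)
  moreover have "z * q z = F_fun \<alpha> (z * 1)" for z
    by (simp add: q_def F_fun_def)
  \<comment> \<open>The choice \<phi> = 1 has P_0 = 1 and P_1 = P_2 = 0, so 12 b_4 = \<alpha> +
    1/2.\<close>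
  ultimately have *: "g1 \<alpha> \<in> class_BK \<alpha>"
    "\<exists>b. has_normalized_expansion (g1 \<alpha>) b \<and> 2 * b 2 = (1 :: complex fps) $ 0 \<and>
      6 * b 3 = (1 :: complex fps) $ 1 + ((1 :: complex fps) $ 0)\<^sup>2 \<and>
      12 * b 4 = (1 :: complex fps) $ 2 + 3/2 * (1 :: complex fps) $ 0 * (1 :: complex fps) $ 1
        + of_real (\<alpha> + 1/2) * ((1 :: complex fps) $ 0) ^ 3"
    unfolding g1
    by (intro extremal_function[OF \<alpha>, of G q "\<lambda>_. 1" 1]; simp add: G_def H_def)+
  show "g1 \<alpha> \<in> class_BK \<alpha>"
    by fact
  show "\<exists>b. has_normalized_expansion (g1 \<alpha>) b \<and> b 2 = 1/2 \<and> b 3 = 1/6 \<and> b 4 = of_real (1 + 2 * \<alpha>) / 24"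
    using *(2) by (auto simp: field_simps)
qed

text \<open>Keeps the base of the power in \<open>g2_integrand\<close> off the branch cut. If the
  quotient is x \<le> 0, then \<zeta> (1 + x) = x - 1, while |x - 1| \<ge> |x + 1|; this forces
  |\<zeta>| \<ge> 1.\<close>

lemma cayley_not_nonpos_Reals:
  fixes \<zeta> :: complex
  assumes "norm \<zeta> < 1"
  shows "(1 + \<zeta>) / (1 - \<zeta>) \<notin> \<real>\<^sub>\<le>\<^sub>0"
proof
  assume "(1 + \<zeta>) / (1 - \<zeta>) \<in> \<real>\<^sub>\<le>\<^sub>0"
  then obtain x where x: "x \<le> 0" "(1 + \<zeta>) / (1 - \<zeta>) = of_real x"
    by (auto elim: nonpos_Reals_cases)
  have "1 - \<zeta> \<noteq> 0"
    using assms by auto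
  then have "\<zeta> * of_real (1 + x) = of_real (x - 1)"
    using x(2) by (simp add: field_simps)
  then have "norm \<zeta> * \<bar>1 + x\<bar> = 1 - x"
    using x(1) by (metis abs_minus_commute abs_of_nonneg diff_ge_0_iff_ge norm_mult norm_of_real order_trans zero_le_one)
  moreover have "norm \<zeta> * \<bar>1 + x\<bar> \<le> 1 * \<bar>1 + x\<bar>"
    using assms by (intro mult_right_mono) auto
  ultimately have "x = 0"
    using x(1) by (simp add: abs_if split: if_splits)
  then show False
    using \<open>norm \<zeta> * \<bar>1 + x\<bar> = 1 - x\<close> assms by simp
qed

text \<open>For s = sqrt \<alpha> > 0 the base w has w'/w = 6 s z^2 / (1 - s^2 z^6), and the
  exponent 1/(6s) removes the factor 6s. The exponential for \<alpha> = 0 fits the same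
  formula.\<close>

lemma g2_integrand_derivative:
  assumes \<alpha>: "0 \<le> \<alpha>" "\<alpha> \<le> 1" and z: "z \<in> unit_disc"
  shows "(g2_integrand \<alpha> has_field_derivative
    g2_integrand \<alpha> z * (z ^ 2 / (1 - of_real \<alpha> * z ^ 6))) (at z)"
proof (cases "\<alpha> = 0")
  case True
  have "g2_integrand \<alpha> = (\<lambda>t. exp (t ^ 3 / 3))"
    using True by (simp add: fun_eq_iff g2_integrand_def)
  then show ?thesis
    using True by (auto intro!: derivative_eq_intros)
next
  case False
  define s where "s = complex_of_real (sqrt \<alpha>)"
  define w where "w t = (1 + s * t ^ 3) / (1 - s * t ^ 3)" for t
  have s0: "s \<noteq> 0"
    using False by (simp add: s_def)
  have s2: "s * s = of_real \<alpha>"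
    using \<alpha> by (simp add: s_def flip: of_real_mult)
  have eq: "g2_integrand \<alpha> = (\<lambda>t. w t powr (1 / (6 * s)))"
    using False by (simp add: fun_eq_iff g2_integrand_def w_def s_def)
  have "norm z ^ 3 < 1"
    using z by (simp add: power_less_one_iff)
  moreover have "sqrt \<alpha> * norm z ^ 3 \<le> 1 * norm z ^ 3"
    using \<alpha> by (intro mult_right_mono) auto
  ultimately have n: "norm (s * z ^ 3) < 1"
    using \<alpha> by (simp add: s_def norm_mult norm_power)
  have w: "w z \<notin> \<real>\<^sub>\<le>\<^sub>0"
    unfolding w_def by (rule cayley_not_nonpos_Reals[OF n])
  have m: "1 - s * z ^ 3 \<noteq> 0"
    using n by auto
  \<comment> \<open>Otherwise w z would be 0, which is a nonpositive real.\<close>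
  have p: "1 + s * z ^ 3 \<noteq> 0"
    using w by (auto simp: w_def)
  have dw: "(w has_field_derivative 6 * s * z ^ 2 / (1 - s * z ^ 3) ^ 2) (at z)"
    unfolding w_def using m
    by (auto intro!: derivative_eq_intros simp: field_simps power2_eq_square)
  have "((\<lambda>t. w t powr (1 / (6 * s))) has_field_derivative
      (1 / (6 * s)) * w z powr (1 / (6 * s) - 1) * (6 * s * z ^ 2 / (1 - s * z ^ 3) ^ 2)) (at z)"
    using DERIV_chain2[OF has_field_derivative_powr[OF w] dw] .
  also have "w z powr (1 / (6 * s) - 1) = w z powr (1 / (6 * s)) / w z"
    using p m by (simp add: powr_diff w_def)
  also have "(1 / (6 * s)) * (w z powr (1 / (6 * s)) / w z) * (6 * s * z ^ 2 / (1 - s * z ^ 3) ^ 2)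
      = w z powr (1 / (6 * s)) * (z ^ 2 / ((1 - s * z ^ 3) * (1 + s * z ^ 3)))"
    using s0 p m by (simp add: w_def power2_eq_square divide_simps)
  also have "(1 - s * z ^ 3) * (1 + s * z ^ 3) = 1 - of_real \<alpha> * z ^ 6"
    unfolding s2[symmetric] by (simp add: algebra_simps eval_nat_numeral)
  finally show ?thesis
    unfolding eq .
qed

lemma g2_extremal:
  assumes \<alpha>: "0 \<le> \<alpha>" "\<alpha> \<le> 1"
  shows "g2 \<alpha> \<in> class_BK \<alpha>"
    "\<exists>b. has_normalized_expansion (g2 \<alpha>) b \<and> b 2 = 0 \<and> b 3 = 0 \<and> b 4 = 1/12"
proof -
  have g2: "g2 \<alpha> = (\<lambda>z. contour_integral (linepath 0 z) (g2_integrand \<alpha>))"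
    by (simp add: fun_eq_iff g2_def)
  have nz: "g2_integrand \<alpha> z \<noteq> 0" if "z \<in> unit_disc" for z
  proof -
    \<comment> \<open>The numerator 1 + sqrt \<alpha> z^3 is the denominator evaluated at
      -z.\<close>
    have "1 - complex_of_real (sqrt \<alpha>) * z ^ 3 \<noteq> 0" "1 - complex_of_real (sqrt \<alpha>) * (- z) ^ 3 \<noteq> 0"
      using that \<alpha> by (intro denominator_nonzero; simp)+
    then show ?thesis
      by (simp add: g2_integrand_def)
  qed
  \<comment> \<open>The choice \<phi>(z) = z^2, with Schwarz function z^3: P_0 = P_1 = 0 and P_2 =
    1, so 12 b_4 = 1.\<close>
  have h: "z * (z ^ 2 / (1 - of_real \<alpha> * z ^ 6)) = F_fun \<alpha> (z * z ^ 2)" for z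
    by (simp add: F_fun_def eval_nat_numeral mult_ac)
  have e: "(\<lambda>z::complex. z ^ 2) has_fps_expansion fps_X ^ 2"
    by (intro fps_expansion_intros)
  have le: "norm ((z::complex) ^ 2) \<le> 1" if "z \<in> unit_disc" for z
    using that by (simp add: norm_power power_le_one)
  note * = extremal_function[OF \<alpha> nz _ g2_integrand_derivative[OF \<alpha>] h _ le e, folded g2]
  show "g2 \<alpha> \<in> class_BK \<alpha>"
    by (rule *(1)) (auto simp: g2_integrand_def intro!: holomorphic_intros)
  have "\<exists>b. has_normalized_expansion (g2 \<alpha>) b \<and> 2 * b 2 = (fps_X ^ 2 :: complex fps) $ 0 \<and>
      6 * b 3 = (fps_X ^ 2 :: complex fps) $ 1 + ((fps_X ^ 2 :: complex fps) $ 0)\<^sup>2 \<and>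
      12 * b 4 = (fps_X ^ 2 :: complex fps) $ 2
        + 3/2 * (fps_X ^ 2 :: complex fps) $ 0 * (fps_X ^ 2 :: complex fps) $ 1
        + of_real (\<alpha> + 1/2) * ((fps_X ^ 2 :: complex fps) $ 0) ^ 3"
    by (rule *(2)) (auto simp: g2_integrand_def intro!: holomorphic_intros)
  then show "\<exists>b. has_normalized_expansion (g2 \<alpha>) b \<and> b 2 = 0 \<and> b 3 = 0 \<and> b 4 = 1/12"
    by (auto simp: fps_X_power_nth field_simps)
qed

text \<open>With \<open>s = sqrt \<beta>\<close> the exponent is one sixth of the difference quotient of
  \<open>Ln ((1 + s w) / (1 - s w))\<close> at \<open>s = 0\<close>.\<close>

lemma g2_integrand_tendsto:
  "((\<lambda>\<beta>. g2_integrand \<beta> t) \<longlongrightarrow> exp (t ^ 3 / 3)) (at_right 0)"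
proof -
  define w where "w = t ^ 3"
  define l where "l s = Ln ((1 + s * w) / (1 - s * w))" for s
  \<comment> \<open>Since l 0 = 0, the quotient l(s)/s tends to 2w, and 2w/6 = t^3/3.\<close>
  have "(l has_field_derivative 2 * w) (at 0)"
    unfolding l_def by (auto intro!: derivative_eq_intros)
  then have "((\<lambda>s. (l s - l 0) / (s - 0)) \<longlongrightarrow> 2 * w) (at 0)"
    by (simp add: has_field_derivative_iff)
  then have "((\<lambda>s. exp (l s / s / 6)) \<longlongrightarrow> exp (2 * w / 6)) (at 0)"
    by (intro tendsto_intros) (auto simp: l_def)
  moreover have sqrt0: "((\<lambda>\<beta>. complex_of_real (sqrt \<beta>)) \<longlongrightarrow> 0) (at_right 0)"
    by (auto intro!: tendsto_eq_intros)
  then have "filterlim (\<lambda>\<beta>. complex_of_real (sqrt \<beta>)) (at 0) (at_right 0)"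
    by (rule filterlim_atI) (auto simp: eventually_at_filter)
  ultimately have lim: "((\<lambda>\<beta>. exp (l (of_real (sqrt \<beta>)) / of_real (sqrt \<beta>) / 6)) \<longlongrightarrow> exp (2 * w / 6)) (at_right 0)"
    by (rule filterlim_compose)
  \<comment> \<open>At base 0 \<open>powr\<close> has the default value 0, so the exponential
    formula needs a nonzero base; this holds for small \<beta> because the base tends to 1.\<close>
  have "((\<lambda>\<beta>. (1 + complex_of_real (sqrt \<beta>) * w) / (1 - complex_of_real (sqrt \<beta>) * w)) \<longlongrightarrow> 1) (at_right 0)"
    using sqrt0 by (auto intro!: tendsto_eq_intros)
  then have "eventually (\<lambda>\<beta>. (1 + complex_of_real (sqrt \<beta>) * w) / (1 - complex_of_real (sqrt \<beta>) * w) \<noteq> 0) (at_right 0)"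
    by (rule tendsto_imp_eventually_ne) simp
  moreover have "eventually (\<lambda>\<beta>::real. \<beta> > 0) (at_right 0)"
    by (simp add: eventually_at_filter)
  ultimately have "eventually (\<lambda>\<beta>. exp (l (of_real (sqrt \<beta>)) / of_real (sqrt \<beta>) / 6) = g2_integrand \<beta> t) (at_right 0)"
    by eventually_elim (auto simp: g2_integrand_def powr_def l_def w_def mult_ac)
  then show ?thesis
    using Lim_transform_eventually[OF lim] by (simp add: w_def)
qed

theorem corollary2p1:
  fixes \<alpha> :: real
  assumes "0 \<le> \<alpha>" and "\<alpha> \<le> 1"
  shows "(\<forall>f\<in>class_BK \<alpha>. \<forall>a. has_normalized_expansion f a \<longrightarrow>
            norm (a 2) \<le> 1 / 2 \<and> norm (a 3) \<le> 1 / 6 \<and>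
            (\<alpha> \<le> 1 / 2 \<longrightarrow> norm (a 4) \<le> 1 / 12) \<and>
            (1 / 2 \<le> \<alpha> \<longrightarrow> norm (a 4) \<le> (1 + 2 * \<alpha>) / 24))
       \<and> g1 \<alpha> \<in> class_BK \<alpha>
       \<and> (\<exists>b. has_normalized_expansion (g1 \<alpha>) b \<and>
            b 2 = 1 / fact 2 \<and> b 3 = 1 / fact 3 \<and> b 4 = of_real (1 + 2 * \<alpha>) / fact 4 \<and>
            norm (b 2) = 1 / 2 \<and> norm (b 3) = 1 / 6 \<and>
            (1 / 2 \<le> \<alpha> \<longrightarrow> norm (b 4) = (1 + 2 * \<alpha>) / 24))
       \<and> (\<forall>t\<in>unit_disc. ((\<lambda>\<beta>. g2_integrand \<beta> t) \<longlongrightarrow> exp (t ^ 3 / 3)) (at_right 0))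
       \<and> g2 \<alpha> \<in> class_BK \<alpha>
       \<and> (\<exists>b. has_normalized_expansion (g2 \<alpha>) b \<and>
            b 2 = 0 \<and> b 3 = 0 \<and> b 4 = 1 / 12 \<and>
            (\<alpha> \<le> 1 / 2 \<longrightarrow> norm (b 4) = 1 / 12))"
proof (intro conjI)
  show "\<forall>f\<in>class_BK \<alpha>. \<forall>a. has_normalized_expansion f a \<longrightarrow>
            norm (a 2) \<le> 1 / 2 \<and> norm (a 3) \<le> 1 / 6 \<and>
            (\<alpha> \<le> 1 / 2 \<longrightarrow> norm (a 4) \<le> 1 / 12) \<and>
            (1 / 2 \<le> \<alpha> \<longrightarrow> norm (a 4) \<le> (1 + 2 * \<alpha>) / 24)"
    using class_BK_coeff_bounds[OF assms] by blast
  show "g1 \<alpha> \<in> class_BK \<alpha>"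
    by (rule g1_extremal[OF assms])
  obtain b where b: "has_normalized_expansion (g1 \<alpha>) b" "b 2 = 1/2" "b 3 = 1/6"
    "b 4 = of_real (1 + 2 * \<alpha>) / 24"
    using g1_extremal(2)[OF assms] by blast
  have "norm (b 2) = 1/2" "norm (b 3) = 1/6"
    by (simp_all add: b(2,3) norm_divide)
  moreover have "norm (b 4) = (1 + 2 * \<alpha>) / 24"
    unfolding b(4) norm_divide norm_of_real using assms by simp
  moreover have "b 2 = 1 / fact 2" "b 3 = 1 / fact 3" "b 4 = of_real (1 + 2 * \<alpha>) / fact 4"
    unfolding b(2-4) by (simp_all add: fact_numeral)
  ultimately show "\<exists>b. has_normalized_expansion (g1 \<alpha>) b \<and>
            b 2 = 1 / fact 2 \<and> b 3 = 1 / fact 3 \<and> b 4 = of_real (1 + 2 * \<alpha>) / fact 4 \<and>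
            norm (b 2) = 1 / 2 \<and> norm (b 3) = 1 / 6 \<and>
            (1 / 2 \<le> \<alpha> \<longrightarrow> norm (b 4) = (1 + 2 * \<alpha>) / 24)"
    using b(1) by blast
  show "\<forall>t\<in>unit_disc. ((\<lambda>\<beta>. g2_integrand \<beta> t) \<longlongrightarrow> exp (t ^ 3 / 3)) (at_right 0)"
    using g2_integrand_tendsto by blast
  show "g2 \<alpha> \<in> class_BK \<alpha>"
    by (rule g2_extremal[OF assms])
  obtain d where d: "has_normalized_expansion (g2 \<alpha>) d" "d 2 = 0" "d 3 = 0" "d 4 = 1/12"
    using g2_extremal(2)[OF assms] by blast
  moreover have "norm (d 4) = 1/12"
    by (simp add: d(4) norm_divide)
  ultimately show "\<exists>b. has_normalized_expansion (g2 \<alpha>) b \<and>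
            b 2 = 0 \<and> b 3 = 0 \<and> b 4 = 1 / 12 \<and>
            (\<alpha> \<le> 1 / 2 \<longrightarrow> norm (b 4) = 1 / 12)"
    by blast
qed

end
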